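(* Let $k\geq 4$ be an even integer and let $n = 3k - 2$. Then $\mathrm{SP}(n,k) \in \left\{\binom{n/2}{2}, \binom{n/2}{2}+1\right\}$.
   Context: For integers $n \geq k \geq 1$, an $(n,k)$-Sperner partition system is a set of partitions of some $n$-set such that each partition has exactly $k$ nonempty parts and no part in any partition is a subset of a part in a different partition. $\mathrm{SP}(n,k)$ denotes the maximum number of partitions in an $(n,k)$-Sperner partition system. *)

theory Defs
  imports Main "HOL-Library.Disjoint_Sets"
begin

definition sperner_partition_system :: "nat \<Rightarrow> nat \<Rightarrow> 'a set \<Rightarrow> 'a set set set \<Rightarrow> bool" where
  "sperner_partition_system n k X S \<longleftrightarrow>
     finite X \<and> card X = n \<and>
     (\<forall>P\<in>S. partition_on X P \<and> card P = k) \<and>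
     (\<forall>P\<in>S. \<forall>Q\<in>S. P \<noteq> Q \<longrightarrow> (\<forall>A\<in>P. \<forall>B\<in>Q. \<not> A \<subseteq> B))"

text \<open>The ground sets range over the \<open>n\<close>-element sets of natural numbers; the lemmas below show that
  the maximum is over a nonempty finite set and that it bounds systems on ground sets of any type.\<close>

definition SP :: "nat \<Rightarrow> nat \<Rightarrow> nat" where
  "SP n k = Max {card S |S. \<exists>X :: nat set. sperner_partition_system n k X S}"

lemma sperner_partition_system_subset_Pow:
  assumes "sperner_partition_system n k X S"
  shows "S \<subseteq> Pow (Pow X)"
  using assms by (auto simp: sperner_partition_system_def partition_on_def)

lemma sperner_partition_system_finite:
  assumes "sperner_partition_system n k X S"
  shows "finite S"
  using sperner_partition_system_subset_Pow[OF assms] assms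
  by (meson finite_Pow_iff finite_subset sperner_partition_system_def)

lemma sperner_partition_system_card_le:
  assumes "sperner_partition_system n k X S"
  shows "card S \<le> 2 ^ 2 ^ n"
proof -
  have fin: "finite X" "card X = n"
    using assms by (auto simp: sperner_partition_system_def)
  then have "card S \<le> card (Pow (Pow X))"
    using sperner_partition_system_subset_Pow[OF assms] by (intro card_mono) auto
  then show ?thesis
    using fin by (simp add: card_Pow)
qed

lemma finite_sperner_partition_system_cards:
  "finite {card S |S. \<exists>X :: 'a set. sperner_partition_system n k X S}"
  by (rule finite_subset[of _ "{..2 ^ 2 ^ n}"]) (auto dest: sperner_partition_system_card_le)

lemma sperner_partition_system_empty:
  "sperner_partition_system n k {..<n} {}"
  by (simp add: sperner_partition_system_def)

lemma SP_attained:
  "\<exists>(X :: nat set) S. sperner_partition_system n k X S \<and> card S = SP n k"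
proof -
  have "SP n k \<in> {card S |S. \<exists>X :: nat set. sperner_partition_system n k X S}"
    unfolding SP_def using sperner_partition_system_empty
    by (intro Max_in finite_sperner_partition_system_cards) blast
  then obtain S and X :: "nat set" where "SP n k = card S" "sperner_partition_system n k X S"
    by blast
  then show ?thesis by (intro exI[of _ X] exI[of _ S]) simp
qed

lemma sperner_partition_system_image:
  assumes S: "sperner_partition_system n k X S" and f: "inj_on f X"
  shows "sperner_partition_system n k (f ` X) ((`) ((`) f) ` S)"
    and "card ((`) ((`) f) ` S) = card S"
proof -
  have inj1: "inj_on ((`) f) (Pow X)"
    using f by (simp add: inj_on_image_Pow)
  then have inj2: "inj_on ((`) ((`) f)) (Pow (Pow X))"
    by (simp add: inj_on_image_Pow)
  note sub = sperner_partition_system_subset_Pow[OF S]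
  show "card ((`) ((`) f) ` S) = card S"
    by (rule card_image) (rule inj_on_subset[OF inj2 sub])
  have part: "partition_on (f ` X) ((`) f ` P) \<and> card ((`) f ` P) = k" if "P \<in> S" for P
  proof -
    have P: "partition_on X P" "card P = k" "P \<subseteq> Pow X"
      using that S sub by (auto simp: sperner_partition_system_def)
    have "disjoint ((`) f ` P)"
    proof (rule disjointI)
      fix C D assume "C \<in> (`) f ` P" "D \<in> (`) f ` P" "C \<noteq> D"
      then obtain A B where AB: "A \<in> P" "B \<in> P" "C = f ` A" "D = f ` B" "A \<noteq> B"
        by auto
      then have "A \<inter> B = {}" "A \<subseteq> X" "B \<subseteq> X"
        using P by (auto simp: partition_on_def disjoint_def)
      then show "C \<inter> D = {}"
        using inj_on_image_Int[OF f, of A B] AB by simp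
    qed
    then have "partition_on (f ` X) ((`) f ` P)"
      using P by (auto simp: partition_on_def)
    moreover have "card ((`) f ` P) = k"
      using card_image[OF inj_on_subset[OF inj1 P(3)]] P(2) by simp
    ultimately show ?thesis ..
  qed
  have sperner: "\<not> f ` A \<subseteq> f ` B" if "P \<in> S" "Q \<in> S" "P \<noteq> Q" "A \<in> P" "B \<in> Q" for P Q A B
  proof -
    have "A \<subseteq> X" "B \<subseteq> X" using sub that by auto
    moreover have "\<not> A \<subseteq> B"
      using S that unfolding sperner_partition_system_def by blast
    ultimately obtain x where x: "x \<in> A" "x \<notin> B" "x \<in> X" "B \<subseteq> X" by blast
    then have "f x \<notin> f ` B"
      using inj_on_image_mem_iff[OF f] by simp
    then show ?thesis using x(1) by blast
  qed
  show "sperner_partition_system n k (f ` X) ((`) ((`) f) ` S)"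
    unfolding sperner_partition_system_def
  proof (intro conjI)
    show "finite (f ` X)" "card (f ` X) = n"
      using S f by (auto simp: sperner_partition_system_def card_image)
    show "\<forall>P\<in>(`) ((`) f) ` S. partition_on (f ` X) P \<and> card P = k"
      using part by auto
    show "\<forall>P\<in>(`) ((`) f) ` S. \<forall>Q\<in>(`) ((`) f) ` S. P \<noteq> Q \<longrightarrow> (\<forall>A\<in>P. \<forall>B\<in>Q. \<not> A \<subseteq> B)"
    proof (intro ballI impI)
      fix P Q C D
      assume "P \<in> (`) ((`) f) ` S" "Q \<in> (`) ((`) f) ` S" "P \<noteq> Q" and CD: "C \<in> P" "D \<in> Q"
      then obtain P' Q' where PQ: "P' \<in> S" "Q' \<in> S" "P = (`) f ` P'" "Q = (`) f ` Q'" "P' \<noteq> Q'"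
        by auto
      with CD obtain A B where "A \<in> P'" "B \<in> Q'" "C = f ` A" "D = f ` B"
        by auto
      with PQ sperner show "\<not> C \<subseteq> D" by simp
    qed
  qed
qed

lemma SP_upper:
  fixes X :: "'a set"
  assumes S: "sperner_partition_system n k X S"
  shows "card S \<le> SP n k"
proof -
  have "finite X" using S by (simp add: sperner_partition_system_def)
  then obtain f :: "'a \<Rightarrow> nat" where f: "inj_on f X"
    using finite_imp_inj_to_nat_seg by blast
  have "card S \<in> {card S |S. \<exists>X :: nat set. sperner_partition_system n k X S}"
    using sperner_partition_system_image[OF S f] by (metis (mono_tags, lifting) mem_Collect_eq)
  then show ?thesis
    unfolding SP_def by (intro Max_ge finite_sperner_partition_system_cards)
qed

end

theory Submission
  imports Defs
begin

text \<open>
  Write \<open>n = 2 h\<close>. For the upper bound, count a part of size \<open>2\<close> with weight \<open>2\<close> per point and a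
  part of size at least \<open>4\<close> with weight \<open>-1\<close> per point. All parts have size at least \<open>2\<close> as
  soon as there are two partitions, and then every partition has total weight at least
  \<open>4 (3 k - n) = 8\<close>, so some point \<open>x\<close> lies in many more parts of size \<open>2\<close> than parts of size at
  least \<open>4\<close>. The parts containing \<open>x\<close>, with \<open>x\<close> removed, form an antichain with one member per
  partition. Its singletons are disjoint from all its other members, and this leaves room for
  too few members of size \<open>2\<close>.

  For the lower bound, split the ground set into two halves of size \<open>h = 3 m - 1\<close>. Baranyai's theorem on
  \<open>h + 1\<close> points, with one point deleted, assigns to each pair \<open>e\<close> of a half a partition of
  its complement into triples, and all these triples are distinct. Use it on both halves at once,
  and cover the two copies of \<open>e = {i, j}\<close> by the pairs joining \<open>i\<close> to \<open>j\<close> across the halves.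
\<close>

section \<open>Hall's marriage theorem, plain and with capacities\<close>

text \<open>The induction distinguishes whether some nonempty proper \<open>J\<close> has no surplus
  of neighbours. If so, \<open>J\<close> is matched on its own and the rest avoids its neighbours.
  If not, every such \<open>J\<close> has a spare neighbour, so one arbitrary assignment can be made
  and removed.\<close>

lemma hall_marriage:
  assumes "finite I" and "\<And>i. i \<in> I \<Longrightarrow> finite (N i)"
    and "\<And>J. J \<subseteq> I \<Longrightarrow> card J \<le> card (\<Union>(N ` J))"
  shows "\<exists>f. inj_on f I \<and> (\<forall>i\<in>I. f i \<in> N i)"
  using assms
proof (induction I arbitrary: N rule: finite_psubset_induct)
  case (psubset I)
  note fin = psubset.prems(1) and hall = psubset.prems(2)
  have finU: "finite (\<Union>(N ` J))" if "J \<subseteq> I" for J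
    using that fin finite_subset[OF that \<open>finite I\<close>] by auto
  consider "I = {}" | J where "J \<subset> I" "J \<noteq> {}" "card (\<Union>(N ` J)) \<le> card J"
    | "I \<noteq> {}" "\<And>J. J \<subset> I \<Longrightarrow> J \<noteq> {} \<Longrightarrow> card J < card (\<Union>(N ` J))"
    by (meson not_le)
  then show ?case
  proof cases
    case 1
    then show ?thesis by simp
  next
    case (2 J)
    let ?U = "\<Union>(N ` J)"
    have J: "J \<subseteq> I" "finite J" using 2 \<open>finite I\<close> by (auto intro: finite_subset)
    obtain f where f: "inj_on f J" "\<forall>i\<in>J. f i \<in> N i"
      using psubset.IH[OF 2(1), of N] fin hall J by (meson order_trans subsetD)
    have "\<exists>g. inj_on g (I - J) \<and> (\<forall>i\<in>I - J. g i \<in> N i - ?U)"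
    proof (rule psubset.IH)
      show "I - J \<subset> I" using 2 by auto
      show "finite (N i - ?U)" if "i \<in> I - J" for i using fin that by auto
      fix K assume K: "K \<subseteq> I - J"
      \<comment> \<open>Hall's condition outside \<open>?U\<close> is the condition for
        \<open>K \<union> J\<close> minus that for \<open>J\<close>, which has at most
        \<open>card J\<close> neighbours.\<close>
      have "card K + card J = card (K \<union> J)"
        using K J \<open>finite I\<close> by (intro card_Un_disjoint[symmetric]) (auto intro: finite_subset)
      also have "\<dots> \<le> card (\<Union>(N ` (K \<union> J)))"
        using K J by (intro hall) auto
      also have "\<Union>(N ` (K \<union> J)) = (\<Union>i\<in>K. N i - ?U) \<union> ?U" by auto
      also have "card \<dots> \<le> card (\<Union>i\<in>K. N i - ?U) + card ?U" by (rule card_Un_le)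
      finally show "card K \<le> card (\<Union>i\<in>K. N i - ?U)" using 2(3) by linarith
    qed
    then obtain g where g: "inj_on g (I - J)" "\<forall>i\<in>I - J. g i \<in> N i - ?U" by blast
    have "f ` J \<inter> g ` (I - J) = {}" using f(2) g(2) by fastforce
    then have "inj_on (\<lambda>i. if i \<in> J then f i else g i) (J \<union> (I - J))"
      by (rule inj_on_disjoint_Un[OF f(1) g(1)])
    moreover have "J \<union> (I - J) = I" using J by auto
    ultimately have "inj_on (\<lambda>i. if i \<in> J then f i else g i) I" by simp
    then show ?thesis using f g by (intro exI[of _ "\<lambda>i. if i \<in> J then f i else g i"]) auto
  next
    case 3
    then obtain i where i: "i \<in> I" by blast
    have "N i \<noteq> {}" using hall[of "{i}"] i by auto
    then obtain y where y: "y \<in> N i" by blast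
    have "\<exists>g. inj_on g (I - {i}) \<and> (\<forall>j\<in>I - {i}. g j \<in> N j - {y})"
    proof (rule psubset.IH)
      show "I - {i} \<subset> I" using i by auto
      show "finite (N j - {y})" if "j \<in> I - {i}" for j using fin that by auto
      fix K assume K: "K \<subseteq> I - {i}"
      have "card K \<le> card (\<Union>(N ` K) - {y})"
      proof (cases "K = {}")
        case False
        then have "card K < card (\<Union>(N ` K))" using K i by (intro 3) auto
        then show ?thesis using finU[of K] K by (auto simp: card_Diff_singleton_if)
      qed simp
      also have "\<Union>(N ` K) - {y} = (\<Union>j\<in>K. N j - {y})" by auto
      finally show "card K \<le> card (\<Union>j\<in>K. N j - {y})" .
    qed
    then obtain g where g: "inj_on g (I - {i})" "\<forall>j\<in>I - {i}. g j \<in> N j - {y}" by blast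
    have "inj_on (g(i := y)) I" using g by (auto simp: inj_on_def)
    moreover have "\<forall>j\<in>I. (g(i := y)) j \<in> N j" using g y by auto
    ultimately show ?thesis by blast
  qed
qed

text \<open>Replace each \<open>s\<close> by \<open>b s\<close> labelled copies, match injectively,
  and forget the labels with \<open>fst\<close>.\<close>

lemma hall_capacities:
  fixes b :: "'b \<Rightarrow> nat"
  assumes fin: "finite I" "\<And>i. i \<in> I \<Longrightarrow> finite (N i)"
    and hall: "\<And>J. J \<subseteq> I \<Longrightarrow> card J \<le> (\<Sum>s\<in>\<Union>(N ` J). b s)"
  shows "\<exists>f. (\<forall>i\<in>I. f i \<in> N i) \<and> (\<forall>s. card {i\<in>I. f i = s} \<le> b s)"
proof -
  let ?N = "\<lambda>i. SIGMA s:N i. {..<b s}"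
  have "\<exists>f. inj_on f I \<and> (\<forall>i\<in>I. f i \<in> ?N i)"
  proof (rule hall_marriage)
    fix J assume J: "J \<subseteq> I"
    have U: "\<Union>(?N ` J) = (SIGMA s:\<Union>(N ` J). {..<b s})" by auto
    have "finite (\<Union>(N ` J))" using J fin finite_subset[OF J] by auto
    then show "card J \<le> card (\<Union>(?N ` J))" using hall[OF J] unfolding U by simp
  qed (use fin in auto)
  then obtain f where f: "inj_on f I" "\<forall>i\<in>I. f i \<in> ?N i" by blast
  have "card {i\<in>I. fst (f i) = s} \<le> b s" for s
  proof -
    have "card {i\<in>I. fst (f i) = s} \<le> card ({s} \<times> {..<b s})"
    proof (rule card_inj_on_le)
      show "inj_on f {i\<in>I. fst (f i) = s}" using f by (auto intro: inj_on_subset)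
      show "f ` {i\<in>I. fst (f i) = s} \<subseteq> {s} \<times> {..<b s}" using f by force
    qed simp
    then show ?thesis by simp
  qed
  then show ?thesis using f by (intro exI[of _ "fst \<circ> f"]) force
qed

section \<open>Baranyai's theorem\<close>

text \<open>A class is encoded as a colouring rather than as a set of sets because several of its
  parts may still be empty, and these have to be counted separately.\<close>

definition part :: "(nat \<Rightarrow> nat) \<Rightarrow> nat \<Rightarrow> nat \<Rightarrow> nat set" where
  "part \<phi> l j = {i. i < l \<and> \<phi> i = j}"

lemma part_subset: "part \<phi> l j \<subseteq> {..<l}" by (auto simp: part_def)

lemma finite_part [simp]: "finite (part \<phi> l j)" by (simp add: part_def)

lemma part_Suc: "part (\<phi>(l := a)) (Suc l) j = (if j = a then insert l (part \<phi> l j) else part \<phi> l j)"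
  by (auto simp: part_def)

lemma sum_card_part:
  assumes "\<forall>i<l. \<phi> i < m"
  shows "(\<Sum>j<m. card (part \<phi> l j)) = l"
proof -
  have "(\<Sum>j<m. card (part \<phi> l j)) = card (\<Union>j<m. part \<phi> l j)"
    by (rule card_UN_disjoint[symmetric]) (auto simp: part_def)
  also have "(\<Union>j<m. part \<phi> l j) = {..<l}" using assms by (auto simp: part_def)
  finally show ?thesis by simp
qed

locale baranyai =
  fixes r m M n :: nat
  assumes n: "n = r * m" and M: "m * M = n choose r"
begin

text \<open>Baranyai's theorem is proved by distributing the points one at a time. A coloring \<open>\<phi> c\<close> of the
  points describes class \<open>c\<close>, with \<open>m\<close> parts some of which may still be empty. The invariant says
  that every \<open>S \<subseteq> {..<l}\<close> is a part as often as it has to be extended to an \<open>r\<close>-set by later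
  points. Giving each part \<open>A\<close> of each class the fraction \<open>(r - card A) / (n - l)\<close> of the next point
  is a fractional solution of the extension step, which yields Hall's condition.\<close>

definition good :: "nat \<Rightarrow> (nat \<Rightarrow> nat \<Rightarrow> nat) \<Rightarrow> bool" where
  "good l \<phi> \<longleftrightarrow>
     (\<forall>c<M. \<forall>i<l. \<phi> c i < m) \<and> (\<forall>c<M. \<forall>j<m. card (part (\<phi> c) l j) \<le> r) \<and>
     (\<forall>S. S \<subseteq> {..<l} \<longrightarrow> card S \<le> r \<longrightarrow>
        card {(c, j). c < M \<and> j < m \<and> part (\<phi> c) l j = S} = (n - l) choose (r - card S))"

lemma good_0: "good 0 (\<lambda>_ _. 0)"
proof -
  have "{(c, j). c < M \<and> j < m} = {..<M} \<times> {..<m}" by auto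
  then show ?thesis using M by (simp add: good_def part_def mult.commute)
qed

lemma good_Suc:
  assumes g: "good l \<phi>" and l: "l < n"
  shows "\<exists>\<psi>. good (Suc l) \<psi>"
proof -
  let ?A = "\<lambda>c. part (\<phi> c) l"
  let ?Q = "\<lambda>S. {(c, j). c < M \<and> j < m \<and> ?A c j = S}"
  \<comment> \<open>This is the number of copies of \<open>S\<close> that must receive the point
    \<open>l\<close>: the invariant at \<open>Suc l\<close> asks for exactly that many parts equal
    to \<open>insert l S\<close>.\<close>
  define b where "b S = (n - Suc l) choose (r - Suc (card S))" for S :: "nat set"
  define N where "N c = {S \<in> ?A c ` {..<m}. card S < r}" for c
  have dom: "\<phi> c i < m" if "c < M" "i < l" for c i using g that by (auto simp: good_def)
  have le: "card (?A c j) \<le> r" if "c < M" "j < m" for c j using g that by (auto simp: good_def)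
  have cnt: "card (?Q S) = (n - l) choose (r - card S)" if "S \<subseteq> {..<l}" "card S \<le> r" for S
    using g that by (auto simp: good_def)
  have finQ: "finite (?Q S)" for S
    by (rule finite_subset[of _ "{..<M} \<times> {..<m}"]) auto
  \<comment> \<open>Up to the factor \<open>n - l\<close>, the fractions given to all copies of
    \<open>S\<close> add up to the capacity \<open>b S\<close>. The next fact says that the
    fractions within one class add up to 1.\<close>
  have absorb: "(r - card S) * card (?Q S) = (n - l) * b S" if "S \<subseteq> {..<l}" "card S < r" for S
  proof -
    have "Suc (n - Suc l) = n - l" "Suc (r - Suc (card S)) = r - card S" using l that by auto
    then show ?thesis
      using Suc_times_binomial_eq[of "n - Suc l" "r - Suc (card S)"] cnt[of S] that
      by (simp add: b_def mult.commute)
  qed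
  have weight: "(\<Sum>j<m. r - card (?A c j)) = n - l" if "c < M" for c
  proof -
    have "(\<Sum>j<m. r - card (?A c j)) = (\<Sum>j<m. r) - (\<Sum>j<m. card (?A c j))"
      using le that by (intro sum_subtractf_nat) auto
    then show ?thesis using sum_card_part[of l "\<phi> c" m] dom that n by (simp add: mult.commute)
  qed
  have fibres: "(\<Sum>x\<in>{(c, j). c < M \<and> j < m \<and> ?A c j \<in> \<U>}. r - card (case x of (c, j) \<Rightarrow> ?A c j))
      = (n - l) * (\<Sum>S\<in>\<U>. b S)" (is "sum ?w ?P = _")
    if U: "\<U> \<subseteq> {S. S \<subseteq> {..<l} \<and> card S < r}" for \<U>
  proof -
    have fU: "finite \<U>" by (rule finite_subset[of _ "Pow {..<l}"]) (use U in auto)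
    have fP: "finite ?P" by (rule finite_subset[of _ "{..<M} \<times> {..<m}"]) auto
    have "sum ?w ?P = (\<Sum>S\<in>\<U>. sum ?w {x\<in>?P. (case x of (c, j) \<Rightarrow> ?A c j) = S})"
      by (rule sum.group[symmetric, OF fP fU]) auto
    also have "\<dots> = (\<Sum>S\<in>\<U>. (n - l) * b S)"
    proof (rule sum.cong[OF refl])
      fix S assume S: "S \<in> \<U>"
      have "{x\<in>?P. (case x of (c, j) \<Rightarrow> ?A c j) = S} = ?Q S" using S by auto
      moreover have "sum ?w (?Q S) = (\<Sum>x\<in>?Q S. r - card S)" by (rule sum.cong) auto
      ultimately show "sum ?w {x\<in>?P. (case x of (c, j) \<Rightarrow> ?A c j) = S} = (n - l) * b S"
        using absorb[of S] U S by (auto simp: mult.commute)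
    qed
    finally show ?thesis by (simp add: sum_distrib_left)
  qed
  \<comment> \<open>Full parts have weight 0, so the sum may be restricted to the parts that can
    still grow.\<close>
  have total: "(n - l) * card J
      = (\<Sum>x\<in>{(c, j). c \<in> J \<and> j < m \<and> card (?A c j) < r}. r - card (case x of (c, j) \<Rightarrow> ?A c j))"
    if J: "J \<subseteq> {..<M}" for J
  proof -
    have "(n - l) * card J = (\<Sum>c\<in>J. \<Sum>j<m. r - card (?A c j))"
      using weight J by (subst sum.cong[OF refl, where h = "\<lambda>_. n - l"]) auto
    also have "\<dots> = (\<Sum>x\<in>J \<times> {..<m}. r - card (case x of (c, j) \<Rightarrow> ?A c j))"
      by (simp add: sum.cartesian_product split_def)
    also have "\<dots> = (\<Sum>x\<in>{(c, j). c \<in> J \<and> j < m \<and> card (?A c j) < r}.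
        r - card (case x of (c, j) \<Rightarrow> ?A c j))"
      using J finite_subset[OF J] by (intro sum.mono_neutral_right) auto
    finally show ?thesis .
  qed
  have "\<exists>f. (\<forall>c\<in>{..<M}. f c \<in> N c) \<and> (\<forall>S. card {c\<in>{..<M}. f c = S} \<le> b S)"
  proof (rule hall_capacities)
    fix J assume J: "J \<subseteq> {..<M}"
    let ?U = "\<Union>(N ` J)"
    have "finite {(c, j). c < M \<and> j < m \<and> ?A c j \<in> ?U}"
      by (rule finite_subset[of _ "{..<M} \<times> {..<m}"]) auto
    \<comment> \<open>The growing parts of the classes in \<open>J\<close> are among all
      occurrences, in any class, of the sets in \<open>?U\<close>. Comparing the two weights gives
      Hall's condition.\<close>
    then have "(n - l) * card J \<le> (n - l) * (\<Sum>S\<in>?U. b S)"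
      unfolding total[OF J] using J
      by (subst fibres[symmetric]) (auto simp: N_def part_def intro!: sum_mono2)
    then show "card J \<le> (\<Sum>S\<in>?U. b S)" using l by simp
  qed (auto simp: N_def)
  then obtain f where f: "\<And>c. c < M \<Longrightarrow> f c \<in> N c"
    and fb: "\<And>S. card {c. c < M \<and> f c = S} \<le> b S"
    by auto
  let ?U = "{S. S \<subseteq> {..<l} \<and> card S < r}"
  have fU: "finite ?U" by (rule finite_subset[of _ "Pow {..<l}"]) auto
  have fN: "f c \<subseteq> {..<l}" "card (f c) < r" if "c < M" for c
    using f[OF that] by (auto simp: N_def part_def)
  have "{(c, j). c < M \<and> j < m \<and> ?A c j \<in> ?U}
      = {(c, j). c \<in> {..<M} \<and> j < m \<and> card (?A c j) < r}"
    using part_subset by auto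
  then have "(n - l) * M = (n - l) * (\<Sum>S\<in>?U. b S)"
    using total[of "{..<M}"] fibres[of ?U] by simp
  then have "(\<Sum>S\<in>?U. b S) = M" using l by simp
  moreover have "(\<Sum>S\<in>?U. card {c. c < M \<and> f c = S}) = M"
  proof -
    have "(\<Sum>S\<in>?U. card {c. c < M \<and> f c = S}) = card (\<Union>S\<in>?U. {c. c < M \<and> f c = S})"
      by (rule card_UN_disjoint[symmetric]) (use fU in auto)
    also have "(\<Union>S\<in>?U. {c. c < M \<and> f c = S}) = {..<M}" using fN by auto
    finally show ?thesis by simp
  qed
  \<comment> \<open>The upper bounds \<open>b S\<close> and the actual counts have the same sum
    \<open>M\<close>, so no bound can be strict.\<close>
  ultimately have fcard: "card {c. c < M \<and> f c = S} = b S" if "S \<subseteq> {..<l}" "card S < r" for S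
    using sum_mono_inv[of "\<lambda>S. card {c. c < M \<and> f c = S}" ?U b S] fb fU that by simp
  \<comment> \<open>\<open>f c\<close> fixes only the contents of the part to be extended. A label
    is ambiguous only when \<open>f c\<close> is empty, and then any choice will do.\<close>
  have "\<forall>c. \<exists>j. c < M \<longrightarrow> j < m \<and> ?A c j = f c"
    using f by (fastforce simp: N_def)
  then obtain a where a: "\<And>c. c < M \<Longrightarrow> a c < m" "\<And>c. c < M \<Longrightarrow> ?A c (a c) = f c"
    by metis
  define \<psi> where "\<psi> c = (\<phi> c)(l := a c)" for c
  have partS: "part (\<psi> c) (Suc l) j = (if j = a c then insert l (?A c j) else ?A c j)" for c j
    unfolding \<psi>_def by (rule part_Suc)
  have "card {(c, j). c < M \<and> j < m \<and> part (\<psi> c) (Suc l) j = S} = (n - Suc l) choose (r - card S)"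
    if S: "S \<subseteq> {..<Suc l}" "card S \<le> r" for S
  proof (cases "l \<in> S")
    case True
    have fin: "finite S" using S finite_subset by auto
    have S': "S - {l} \<subseteq> {..<l}" using S by (auto simp: less_Suc_eq)
    have "card S > 0" using True fin by (auto simp: card_gt_0_iff)
    have "?A c j \<noteq> S" for c j using True by (auto simp: part_def)
    moreover have "l \<notin> f c" if "c < M" for c using fN(1)[OF that] by auto
    moreover have "insert l (f c) = S \<longleftrightarrow> f c = S - {l}" if "c < M" for c
      using fN(1)[OF that] True by auto
    ultimately have "{(c, j). c < M \<and> j < m \<and> part (\<psi> c) (Suc l) j = S}
        = (\<lambda>c. (c, a c)) ` {c. c < M \<and> f c = S - {l}}"
      using a by (auto simp: partS image_iff split: if_splits)
    then have "card {(c, j). c < M \<and> j < m \<and> part (\<psi> c) (Suc l) j = S}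
        = card {c. c < M \<and> f c = S - {l}}"
      by (simp add: card_image inj_on_def)
    then show ?thesis
      using fcard[OF S'] True S \<open>card S > 0\<close> fin by (simp add: b_def card_Diff_singleton)
  next
    case False
    then have S': "S \<subseteq> {..<l}" using S by (auto simp: less_Suc_eq)
    have sub: "(\<lambda>c. (c, a c)) ` {c. c < M \<and> f c = S} \<subseteq> ?Q S" using a by auto
    have "{(c, j). c < M \<and> j < m \<and> part (\<psi> c) (Suc l) j = S}
        = ?Q S - (\<lambda>c. (c, a c)) ` {c. c < M \<and> f c = S}"
      using False a by (auto simp: partS split: if_splits)
    then have "card {(c, j). c < M \<and> j < m \<and> part (\<psi> c) (Suc l) j = S}
        = card (?Q S) - card {c. c < M \<and> f c = S}"
      using card_Diff_subset[OF finite_subset[OF sub finQ] sub]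
      by (simp add: card_image inj_on_def)
    \<comment> \<open>For \<open>card S < r\<close> this is Pascal's rule. For
      \<open>card S = r\<close> no copy is extended, and both binomials are 1.\<close>
    also have "\<dots> = (n - Suc l) choose (r - card S)"
    proof (cases "card S < r")
      case True
      have "n - l = Suc (n - Suc l)" "r - card S = Suc (r - Suc (card S))" using l True by auto
      then show ?thesis using cnt[OF S' S(2)] fcard[OF S' True] by (simp add: b_def)
    next
      case False
      then have none: "{c. c < M \<and> f c = S} = {}" using fN(2) by auto
      show ?thesis unfolding none using cnt[OF S' S(2)] S(2) False by simp
    qed
    finally show ?thesis .
  qed
  moreover have "card (part (\<psi> c) (Suc l) j) \<le> r" if "c < M" "j < m" for c j
    using le[OF that] fN(2)[OF that(1)] a(2)[OF that(1)] finite_subset[OF fN(1)[OF that(1)]]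
    by (auto simp: partS card_insert_if)
  moreover have "\<psi> c i < m" if "c < M" "i < Suc l" for c i
    using dom that a by (auto simp: \<psi>_def less_Suc_eq)
  ultimately show ?thesis unfolding good_def by blast
qed

text \<open>At \<open>l = n\<close> the invariant counts \<open>0 choose (r - card S)\<close>, which
  is 1 for \<open>r\<close>-sets. The parts of a class have size at most \<open>r\<close> and total
  size \<open>r * m\<close>, so all of them are \<open>r\<close>-sets.\<close>

lemma baranyai:
  "\<exists>\<phi>. (\<forall>c<M. \<forall>i<n. \<phi> c i < m) \<and>
     bij_betw (\<lambda>(c, j). part (\<phi> c) n j) ({..<M} \<times> {..<m}) {S. S \<subseteq> {..<n} \<and> card S = r}"
proof -
  have "\<exists>\<phi>. good l \<phi>" if "l \<le> n" for l
    using that by (induction l) (use good_0 good_Suc in \<open>auto simp: Suc_le_eq\<close>)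
  then obtain \<phi> where g: "good n \<phi>" by blast
  let ?A = "\<lambda>(c, j). part (\<phi> c) n j"
  have dom: "\<phi> c i < m" if "c < M" "i < n" for c i using g that by (auto simp: good_def)
  have le: "card (part (\<phi> c) n j) \<le> r" if "c < M" "j < m" for c j
    using g that by (auto simp: good_def)
  have eq: "card (part (\<phi> c) n j) = r" if "c < M" "j < m" for c j
  proof -
    have "(\<Sum>j<m. card (part (\<phi> c) n j)) = (\<Sum>j<m. r)"
      using sum_card_part[of n "\<phi> c" m] dom that n by (simp add: mult.commute)
    then show ?thesis
      using sum_mono_inv[of "\<lambda>j. card (part (\<phi> c) n j)" "{..<m}" "\<lambda>_. r" j] le that by simp
  qed
  have ex1: "\<exists>p. {(c, j). c < M \<and> j < m \<and> part (\<phi> c) n j = S} = {p}"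
    if "S \<subseteq> {..<n}" "card S = r" for S
  proof -
    have "card {(c, j). c < M \<and> j < m \<and> part (\<phi> c) n j = S} = 1"
      using g that by (auto simp: good_def)
    then show ?thesis by (auto simp: card_1_singleton_iff)
  qed
  have "bij_betw ?A ({..<M} \<times> {..<m}) {S. S \<subseteq> {..<n} \<and> card S = r}"
  proof (intro bij_betw_imageI inj_onI set_eqI iffI)
    fix p q assume pq: "p \<in> {..<M} \<times> {..<m}" "q \<in> {..<M} \<times> {..<m}" "?A p = ?A q"
    obtain c j where "p = (c, j)" by (cases p)
    then have "card (?A p) = r" "?A p \<subseteq> {..<n}"
      using pq eq[of c j] part_subset[of "\<phi> c" n j] by simp_all
    then obtain z where z: "{(c, j). c < M \<and> j < m \<and> part (\<phi> c) n j = ?A p} = {z}"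
      using ex1 by blast
    have "p \<in> {(c, j). c < M \<and> j < m \<and> part (\<phi> c) n j = ?A p}"
      "q \<in> {(c, j). c < M \<and> j < m \<and> part (\<phi> c) n j = ?A p}"
      using pq by auto
    then show "p = q" unfolding z by simp
  next
    fix S assume "S \<in> {S. S \<subseteq> {..<n} \<and> card S = r}"
    then obtain z where z: "{(c, j). c < M \<and> j < m \<and> part (\<phi> c) n j = S} = {z}"
      using ex1 by blast
    have "z \<in> {(c, j). c < M \<and> j < m \<and> part (\<phi> c) n j = S}" unfolding z by simp
    then show "S \<in> ?A ` ({..<M} \<times> {..<m})" by force
  next
    fix S assume "S \<in> ?A ` ({..<M} \<times> {..<m})"
    then show "S \<in> {S. S \<subseteq> {..<n} \<and> card S = r}" using eq by (auto simp: part_def)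
  qed
  then show ?thesis using dom by blast
qed

end

section \<open>Lower bound: the construction from two halves\<close>

text \<open>The extra point is \<open>h\<close>. A pair \<open>e\<close> is sent to the class
  containing the triple \<open>insert h e\<close>, whose remaining triples form
  \<open>T e\<close>.\<close>

lemma pairs_and_triples_decomposition:
  fixes h m :: nat
  assumes h: "Suc h = 3 * m"
  shows "\<exists>T. \<forall>e\<in>{e. e \<subseteq> {..<h} \<and> card e = 2}.
    partition_on ({..<h} - e) (T e) \<and> (\<forall>B\<in>T e. card B = 3) \<and>
    (\<forall>e'\<in>{e. e \<subseteq> {..<h} \<and> card e = 2}. e \<noteq> e' \<longrightarrow> T e \<inter> T e' = {})"
proof -
  interpret baranyai 3 m "h choose 2" "Suc h"
  proof
    have "3 * (Suc h choose 3) = Suc h * (h choose 2)"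
      using Suc_times_binomial[of 2 h] by (simp add: numeral_3_eq_3 numeral_2_eq_2)
    then show "m * (h choose 2) = Suc h choose 3" using h by simp
  qed (fact h)
  obtain \<phi> where dom: "\<And>c i. c < h choose 2 \<Longrightarrow> i < Suc h \<Longrightarrow> \<phi> c i < m"
    and bij: "bij_betw (\<lambda>(c, j). part (\<phi> c) (Suc h) j) ({..<h choose 2} \<times> {..<m})
      {S. S \<subseteq> {..<Suc h} \<and> card S = 3}"
    using baranyai by blast
  let ?A = "\<lambda>c. part (\<phi> c) (Suc h)"
  let ?pair = "\<lambda>e. e \<subseteq> {..<h} \<and> card e = 2"
  have card3: "card (?A c j) = 3" if "c < h choose 2" "j < m" for c j
    using bij_betwE[OF bij] that by auto
  have uniq: "c = c'" if "c < h choose 2" "j < m" "c' < h choose 2" "j' < m" "?A c j = ?A c' j'"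
    for c j c' j'
    using inj_onD[OF bij_betw_imp_inj_on[OF bij], of "(c, j)" "(c', j')"] that by simp
  have part: "partition_on {..<Suc h} (?A c ` {..<m})" if "c < h choose 2" for c
  proof (rule partition_onI)
    show "\<Union>(?A c ` {..<m}) = {..<Suc h}" using dom[OF that] by (auto simp: part_def)
    show "{} \<notin> ?A c ` {..<m}" using card3[OF that] by (metis card.empty imageE lessThan_iff zero_neq_numeral)
  qed (auto simp: part_def disjnt_def)
  have pair3: "insert h e \<subseteq> {..<Suc h}" "card (insert h e) = 3" "h \<notin> e" if "?pair e" for e
  proof -
    show "h \<notin> e" using that by auto
    moreover have "finite e" using that finite_subset by blast
    ultimately show "card (insert h e) = 3" using that by simp
    show "insert h e \<subseteq> {..<Suc h}" using that by auto
  qed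
  have "\<exists>c. ?pair e \<longrightarrow> c < h choose 2 \<and> (\<exists>j<m. ?A c j = insert h e)" for e
  proof (cases "?pair e")
    case True
    then have "insert h e \<in> (\<lambda>(c, j). ?A c j) ` ({..<h choose 2} \<times> {..<m})"
      unfolding bij_betw_imp_surj_on[OF bij] using pair3(1,2)[OF True] by simp
    then show ?thesis by auto
  qed blast
  then obtain cls where cls: "\<And>e. ?pair e \<Longrightarrow> cls e < h choose 2"
      "\<And>e. ?pair e \<Longrightarrow> \<exists>j<m. ?A (cls e) j = insert h e"
    by metis
  define T where "T e = ?A (cls e) ` {..<m} - {insert h e}" for e
  have "partition_on ({..<h} - e) (T e)" if e: "?pair e" for e
  proof -
    have ins: "insert (insert h e) (T e) = ?A (cls e) ` {..<m}"
      using cls(2)[OF e] by (auto simp: T_def)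
    obtain j where j: "?A (cls e) j = insert h e" using cls(2)[OF e] by blast
    have "?A (cls e) i \<inter> insert h e = {}" if "?A (cls e) i \<noteq> insert h e" for i
      using that unfolding j[symmetric] by (auto simp: part_def)
    then have "disjnt (insert h e) (\<Union>(T e))" unfolding T_def disjnt_def by blast
    then have "partition_on ({..<Suc h} - insert h e) (T e)"
      using part[OF cls(1)[OF e]] partition_on_insert unfolding ins[symmetric] by metis
    moreover have "{..<Suc h} - insert h e = {..<h} - e" by auto
    ultimately show ?thesis by simp
  qed
  moreover have "card B = 3" if "?pair e" "B \<in> T e" for e B
    using that card3 cls(1) by (auto simp: T_def)
  moreover have "T e \<inter> T e' = {}" if e: "?pair e" "?pair e'" "e \<noteq> e'" for e e'
  proof (rule ccontr)
    assume "T e \<inter> T e' \<noteq> {}"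
    then obtain j j' where j: "j < m" "j' < m" "?A (cls e) j = ?A (cls e') j'"
      unfolding T_def by blast
    \<comment> \<open>Every triple lies in only one class, so a shared triple identifies the
      classes. The part through \<open>h\<close> is unique in a class, which then identifies the
      pairs.\<close>
    have "cls e = cls e'"
      using uniq j cls(1)[OF e(1)] cls(1)[OF e(2)] by blast
    moreover obtain i i' where i: "?A (cls e) i = insert h e" "?A (cls e') i' = insert h e'"
      using cls(2)[OF e(1)] cls(2)[OF e(2)] by blast
    moreover have "h \<in> ?A (cls e) i" "h \<in> ?A (cls e') i'" unfolding i by auto
    then have "\<phi> (cls e) h = i" "\<phi> (cls e') h = i'" by (simp_all add: part_def)
    ultimately have "insert h e = insert h e'" by metis
    then show False using e pair3(3) by (metis insert_ident)
  qed
  ultimately show ?thesis by (intro exI[of _ T]) simp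
qed

lemma partition_on_Un_disjoint:
  assumes "partition_on A P" "partition_on B Q" "A \<inter> B = {}"
  shows "partition_on (A \<union> B) (P \<union> Q)"
proof (rule partition_onI)
  show "\<Union>(P \<union> Q) = A \<union> B" "{} \<notin> P \<union> Q" using assms by (auto simp: partition_on_def)
  fix p q assume "p \<in> P \<union> Q" "q \<in> P \<union> Q" "p \<noteq> q"
  moreover have "p' \<inter> q' = {} \<and> q' \<inter> p' = {}" if "p' \<in> P" "q' \<in> Q" for p' q'
    using assms that by (auto simp: partition_on_def)
  ultimately show "disjnt p q"
    using disjointD[OF partition_onD2[OF assms(1)]] disjointD[OF partition_onD2[OF assms(2)]]
    unfolding disjnt_def by (elim UnE) simp_all
qed

text \<open>Each pair \<open>e\<close> gives two crossing pairs and \<open>m - 1\<close> triples in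
  each copy, hence \<open>2 * m\<close> parts.\<close>

lemma exists_sperner_partition_system:
  fixes h m :: nat
  assumes h: "Suc h = 3 * m"
  shows "\<exists>X :: (nat \<times> bool) set. \<exists>S. sperner_partition_system (2 * h) (2 * m) X S \<and> card S = h choose 2"
proof -
  let ?pair = "\<lambda>e. e \<subseteq> {..<h} \<and> card e = 2"
  obtain T where decomp: "\<forall>e\<in>{e. ?pair e}. partition_on ({..<h} - e) (T e) \<and>
      (\<forall>B\<in>T e. card B = 3) \<and> (\<forall>e'\<in>{e. ?pair e}. e \<noteq> e' \<longrightarrow> T e \<inter> T e' = {})"
    using pairs_and_triples_decomposition[OF h] by blast
  have T: "partition_on ({..<h} - e) (T e)" "B \<in> T e \<Longrightarrow> card B = 3" if "?pair e" for e B
    using bspec[OF decomp, of e] that by auto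
  have T_disj: "T e \<inter> T e' = {}" if "?pair e" "?pair e'" "e \<noteq> e'" for e e'
    using bspec[OF decomp, of e] that by auto
  define copy :: "bool \<Rightarrow> nat set \<Rightarrow> (nat \<times> bool) set" where "copy s B = (\<lambda>i. (i, s)) ` B" for s B
  \<comment> \<open>Both orders of the two elements of \<open>e\<close> occur, so the two resulting
    pairs cover \<open>e\<close> in both copies.\<close>
  define cross :: "nat set \<Rightarrow> (nat \<times> bool) set set"
    where "cross e = {{(i, False), (j, True)} |i j. e = {i, j} \<and> i \<noteq> j}" for e
  define P where "P e = cross e \<union> (copy False ` T e \<union> copy True ` T e)" for e
  let ?X = "{..<h} \<times> (UNIV :: bool set)"
  let ?E = "{e. ?pair e}"
  have copy_inj: "copy s B = copy s B' \<longleftrightarrow> B = B'" for s B B'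
    by (auto simp: copy_def)
  have card_copy: "card (copy s B) = card B" for s B
    unfolding copy_def by (intro card_image) (auto simp: inj_on_def)
  have cross_pair: "cross {i, j} = {{(i, False), (j, True)}, {(j, False), (i, True)}}"
    if "i \<noteq> j" for i j
    using that by (auto simp: cross_def doubleton_eq_iff)
  have cross_card: "card A = 2" if "A \<in> cross e" for A e
    using that by (auto simp: cross_def)
  have T_card: "card A = 3" if "?pair e" "A \<in> copy s ` T e" for A e s
    using that T(2) card_copy by auto
  have part: "partition_on ?X (P e)" if e: "?pair e" for e
  proof -
    have copies: "partition_on (copy s ({..<h} - e)) (copy s ` T e)" for s
    proof -
      have "partition_on (copy s ({..<h} - e)) (copy s ` T e - {{}})"
        unfolding copy_def
        using partition_on_inj_image[OF T(1)[OF e], of "\<lambda>i. (i, s)"] by (simp add: inj_on_def)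
      moreover have "{} \<notin> copy s ` T e" using T_card[OF e] by (metis card.empty zero_neq_numeral)
      ultimately show ?thesis by simp
    qed
    obtain i j where ij: "e = {i, j}" "i \<noteq> j" using e by (auto simp: card_2_iff)
    have "partition_on (e \<times> UNIV) (cross e)"
      using ij(2) unfolding ij(1) cross_pair[OF ij(2)]
      by (intro partition_onI) (auto simp: disjnt_def UNIV_bool)
    then have "partition_on (e \<times> UNIV \<union> (copy False ({..<h} - e) \<union> copy True ({..<h} - e))) (P e)"
      unfolding P_def by (intro partition_on_Un_disjoint copies) (auto simp: copy_def)
    moreover have "e \<times> UNIV \<union> (copy False ({..<h} - e) \<union> copy True ({..<h} - e)) = ?X"
      using e by (auto simp: copy_def UNIV_bool)
    ultimately show ?thesis by simp
  qed
  have card_P: "card (P e) = 2 * m" if e: "?pair e" for e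
  proof -
    have finT: "finite (T e)" using finite_elements[OF _ T(1)[OF e]] by simp
    have fin_e: "finite e" using e finite_subset by blast
    have "card ({..<h} - e) = sum card (T e)"
    proof (rule product_partition[OF T(1)[OF e]])
      show "finite B" if "B \<in> T e" for B using T(2)[OF e that] by (simp add: card_ge_0_finite)
    qed
    then have "h - 2 = 3 * card (T e)"
      using T(2)[OF e] e card_Diff_subset[OF fin_e, of "{..<h}"] by simp
    moreover have "h \<ge> 2" using e card_mono[of "{..<h}" e] by simp
    ultimately have cT: "Suc (card (T e)) = m" using h by linarith
    have card_c: "card (copy s ` T e) = card (T e)" for s
      by (intro card_image) (auto simp: inj_on_def copy_inj)
    have "copy False ` T e \<inter> copy True ` T e = {}"
    proof -
      have "copy False B \<noteq> copy True B'" if "B \<in> T e" for B B'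
      proof -
        have "B \<noteq> {}" using T(2)[OF e that] by auto
        then show ?thesis by (auto simp: copy_def)
      qed
      then show ?thesis by blast
    qed
    moreover have "B \<notin> cross e" if "B \<in> copy s ` T e" for B s
      using T_card[OF e that] cross_card[of B e] by auto
    then have "cross e \<inter> (copy False ` T e \<union> copy True ` T e) = {}" by blast
    moreover have "card (cross e) = 2 \<and> finite (cross e)"
    proof -
      obtain i j where ij: "e = {i, j}" "i \<noteq> j" using e by (auto simp: card_2_iff)
      then show ?thesis unfolding ij(1) cross_pair[OF ij(2)] by (auto simp: doubleton_eq_iff)
    qed
    ultimately show ?thesis
      unfolding P_def using finT cT by (simp add: card_Un_disjoint card_c)
  qed
  have sperner: "\<not> A \<subseteq> B" if e: "?pair e" "?pair e'" "e \<noteq> e'" and AB: "A \<in> P e" "B \<in> P e'" for e e' A B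
  proof
    assume sub: "A \<subseteq> B"
    have "B \<in> cross e' \<or> B \<in> copy False ` T e' \<or> B \<in> copy True ` T e'"
      using AB(2) unfolding P_def by blast
    then have "card B \<noteq> 0" using cross_card T_card[OF e(2)] by (metis zero_neq_numeral)
    then have fin: "finite B" by (meson card.infinite)
    \<comment> \<open>A crossing pair does not fit into one copy, and a triple does not fit into a
      pair. Parts of equal size would coincide, but crossing pairs determine \<open>e\<close> and
      the triples of different pairs are disjoint families.\<close>
    consider "A \<in> cross e" "B \<in> cross e'" | s where "A \<in> cross e" "B \<in> copy s ` T e'"
      | s where "A \<in> copy s ` T e" "B \<in> cross e'"
      | s s' where "A \<in> copy s ` T e" "B \<in> copy s' ` T e'"
      using AB unfolding P_def by blast
    then show False
    proof cases
      case 1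
      then have "A = B" using sub cross_card fin by (metis card_subset_eq)
      then show False using 1 e by (auto simp: cross_def doubleton_eq_iff)
    next
      case 2
      then show False using sub by (auto simp: cross_def copy_def)
    next
      case 3
      then have "card A = 3" "card B = 2" using T_card[OF e(1)] cross_card by auto
      then show False using card_mono[OF fin sub] by simp
    next
      case (4 s s')
      then have c: "card A = 3" "card B = 3" using T_card e by auto
      then have "A = B" using sub fin by (metis card_subset_eq)
      obtain C D where CD: "A = copy s C" "B = copy s' D" "C \<in> T e" "D \<in> T e'" using 4 by blast
      moreover have "A \<noteq> {}" using c by auto
      ultimately have "s = s'" using \<open>A = B\<close> by (auto simp: copy_def)
      then have "C = D" using CD \<open>A = B\<close> copy_inj by simp
      then show False using CD T_disj[OF e] by blast
    qed
  qed
  have "inj_on P ?E"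
  proof (rule inj_onI, rule ccontr)
    fix e e' assume e: "e \<in> ?E" "e' \<in> ?E" "P e = P e'" "e \<noteq> e'"
    obtain i j where "e = {i, j}" "i \<noteq> j" using e(1) by (auto simp: card_2_iff)
    then obtain A where "A \<in> P e" unfolding P_def by (auto simp: cross_pair)
    then show False using sperner[of e e' A A] e by auto
  qed
  then have "card (P ` ?E) = h choose 2"
    using n_subsets[of "{..<h}" 2] by (simp add: card_image)
  moreover have "sperner_partition_system (2 * h) (2 * m) ?X (P ` ?E)"
    unfolding sperner_partition_system_def
  proof (intro conjI ballI impI)
    fix R Q A B assume "R \<in> P ` ?E" "Q \<in> P ` ?E" "R \<noteq> Q" "A \<in> R" "B \<in> Q"
    then show "\<not> A \<subseteq> B" using sperner by blast
  qed (use part card_P in auto)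
  ultimately show ?thesis by blast
qed

section \<open>Upper bound: antichains and weights\<close>

text \<open>Larger members avoid all singleton members, so they live on the \<open>q\<close>
  remaining points. A member of size at least 3 excludes its own 2-subsets, of which there are at
  least three.\<close>

lemma antichain_size_profile:
  fixes F :: "'a set set"
  assumes V: "finite V" "\<And>A. A \<in> F \<Longrightarrow> A \<subseteq> V"
    and anti: "\<And>A B. A \<in> F \<Longrightarrow> B \<in> F \<Longrightarrow> A \<noteq> B \<Longrightarrow> \<not> A \<subseteq> B"
  defines "q \<equiv> card V - card {A\<in>F. card A = 1}"
  shows "card {A\<in>F. card A = 1} \<le> card V"
    and "card {A\<in>F. card A = 2} \<le> q choose 2"
    and "{A\<in>F. card A \<ge> 3} \<noteq> {} \<Longrightarrow> card {A\<in>F. card A = 2} + 3 \<le> q choose 2"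
proof -
  let ?D = "\<Union>{A\<in>F. card A = 1}"
  have "card ?D = sum card {A\<in>F. card A = 1}"
    by (rule card_Union_disjoint) (auto simp: pairwise_def disjnt_def card_1_singleton_iff card_ge_0_finite)
  then have D: "card ?D = card {A\<in>F. card A = 1}" by simp
  have DV: "?D \<subseteq> V" using V by auto
  show "card {A\<in>F. card A = 1} \<le> card V" using card_mono[OF V(1) DV] D by simp
  let ?R = "V - ?D"
  have R: "finite ?R" "card ?R = q"
    using V(1) card_Diff_subset[OF finite_subset[OF DV V(1)] DV] D by (auto simp: q_def)
  have in_R: "A \<subseteq> ?R" if "A \<in> F" "card A \<ge> 2" for A
  proof -
    have "A \<inter> B = {}" if "B \<in> F" "card B = 1" for B
    proof -
      have "B \<noteq> A" using that(2) \<open>card A \<ge> 2\<close> by auto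
      then have "\<not> B \<subseteq> A" using anti that \<open>A \<in> F\<close> by blast
      then show ?thesis using that(2) by (auto simp: card_1_singleton_iff)
    qed
    then show ?thesis using V(2)[OF that(1)] by auto
  qed
  have sub: "{A\<in>F. card A = 2} \<subseteq> {A. A \<subseteq> ?R \<and> card A = 2}"
    using in_R by (intro Collect_mono conjI impI) auto
  have pairs: "finite {A. A \<subseteq> ?R \<and> card A = 2}" "card {A. A \<subseteq> ?R \<and> card A = 2} = q choose 2"
    using n_subsets[OF R(1), of 2] R by auto
  show "card {A\<in>F. card A = 2} \<le> q choose 2" using card_mono[OF pairs(1) sub] pairs(2) by simp
  assume "{A\<in>F. card A \<ge> 3} \<noteq> {}"
  then obtain Y where Y: "Y \<in> F" "card Y \<ge> 3" by blast
  let ?Y2 = "{A. A \<subseteq> Y \<and> card A = 2}"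
  have finY: "finite Y" using V Y finite_subset by blast
  have dis: "?Y2 \<inter> {A\<in>F. card A = 2} = {}" using anti[OF _ Y(1)] Y(2) by fastforce
  have Un: "?Y2 \<union> {A\<in>F. card A = 2} \<subseteq> {A. A \<subseteq> ?R \<and> card A = 2}"
    using sub in_R[OF Y(1)] Y(2) by auto
  have fin: "finite ?Y2" "finite {A\<in>F. card A = 2}"
    using finY finite_subset[OF sub pairs(1)] by auto
  have "card ?Y2 + card {A\<in>F. card A = 2} \<le> card {A. A \<subseteq> ?R \<and> card A = 2}"
    using card_mono[OF pairs(1) Un] card_Un_disjoint[OF fin dis] by simp
  moreover have "card ?Y2 \<ge> 3"
    using n_subsets[OF finY, of 2] binomial_right_mono[OF Y(2), of 2] by (simp add: choose_two)
  ultimately show "card {A\<in>F. card A = 2} + 3 \<le> q choose 2" using pairs(2) by linarith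
qed

lemma int_choose_two: "2 * int (n choose 2) = int n * (int n - 1)"
proof -
  have "2 * (n choose 2) = n * (n - 1)"
    using times_binomial_minus1_eq[of 2 n] by simp
  then have "int (2 * (n choose 2)) = int (n * (n - 1))" by (rule arg_cong)
  then show ?thesis by (cases n) (simp_all add: algebra_simps)
qed

text \<open>Here \<open>d\<close>, \<open>b\<close> and \<open>E\<close> count antichain members of
  size 1, 2 and at least 3, on \<open>2 * h - 1\<close> points of which \<open>q\<close> lie in no
  singleton.\<close>

lemma extremal_inequality:
  fixes q d b E h :: nat
  assumes h: "h \<ge> 5" and q: "d + q + 1 = 2 * h" and E: "E + 2 * h \<le> 2 * d + 1"
    and b: "b \<le> q choose 2" and bE: "E > 0 \<Longrightarrow> b + 3 \<le> q choose 2"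
  shows "d + b + E \<le> (h choose 2) + 1"
proof (cases "q \<le> 1")
  \<comment> \<open>Without room for a pair, \<open>b\<close> and \<open>E\<close> vanish and only
    \<open>d \<le> 2 * h - 1\<close> remains; this is where \<open>h \<ge> 5\<close> enters.\<close>
  case True
  then have q2: "q choose 2 = 0" by (simp add: binomial_eq_0)
  then have "b = 0" using b by linarith
  moreover have "E = 0" using bE unfolding q2 by (cases E) auto
  moreover have "4 * h \<le> h * (h - 1)" using h by (simp add: mult.commute)
  moreover have "2 * (h choose 2) = h * (h - 1)" using times_binomial_minus1_eq[of 2 h] by simp
  ultimately show ?thesis using q by linarith
next
  case False
  \<comment> \<open>The hypothesis on \<open>E\<close> forces \<open>t \<ge> 1\<close>. The gain
    from \<open>q choose 2\<close> to \<open>h choose 2\<close> must then pay for \<open>d\<close>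
    and \<open>E\<close>.\<close>
  define t where "t = int h - int q"
  have t: "t \<ge> 1" "int h = int q + t" "int d = int q + 2 * t - 1" "int E \<le> 2 * t - 1"
    using q E by (auto simp: t_def)
  have q2: "int q \<ge> 2" using False by simp
  have hh: "2 * int (h choose 2) = 2 * int (q choose 2) + (2 * int q * t + t * t - t)"
    unfolding int_choose_two t(2) by (simp add: algebra_simps)
  have "2 * int (d + b + E) \<le> 2 * int (h choose 2) + 2"
  proof (cases "E = 0")
    case True
    \<comment> \<open>This product is twice the slack when \<open>b = q choose 2\<close>. It
      vanishes at \<open>t = 1\<close>, which is why the bound carries the extra 1.\<close>
    have "0 \<le> (t - 1) * (2 * int q + t - 4)" using t(1) q2 by simp
    then show ?thesis using True b t hh by (simp add: algebra_simps)
  next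
    case False
    then have "int b + 3 \<le> int (q choose 2)" using bE by simp
    moreover have "4 * (t - 1) \<le> 2 * int q * (t - 1)"
      using t(1) q2 by (intro mult_right_mono) auto
    moreover have "0 \<le> (2 * t - 5) * (2 * t - 5)" by simp
    ultimately show ?thesis using t hh by (simp add: algebra_simps)
  qed
  then have "int (d + b + E) \<le> int ((h choose 2) + 1)" unfolding of_nat_add by simp
  then show ?thesis by (simp only: of_nat_le_iff)
qed

lemma sperner_partition_system_card_bound:
  assumes S: "sperner_partition_system n k X S" and n: "n = 3 * k - 2" "n = 2 * h" and h: "h \<ge> 5"
  shows "card S \<le> (h choose 2) + 1"
proof (rule ccontr)
  assume "\<not> ?thesis"
  then have big: "card S \<ge> (h choose 2) + 2" by simp
  have X: "finite X" "card X = n" and part: "\<And>P. P \<in> S \<Longrightarrow> partition_on X P"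
    and card_k: "\<And>P. P \<in> S \<Longrightarrow> card P = k"
    and sperner: "\<And>P Q A B. P \<in> S \<Longrightarrow> Q \<in> S \<Longrightarrow> P \<noteq> Q \<Longrightarrow> A \<in> P \<Longrightarrow> B \<in> Q \<Longrightarrow> \<not> A \<subseteq> B"
    using S by (auto simp: sperner_partition_system_def)
  have finS: "finite S" by (rule sperner_partition_system_finite[OF S])
  have finA: "finite A" if "P \<in> S" "A \<in> P" for P A
    using partition_onD1[OF part[OF that(1)]] that(2) X(1) by (metis Sup_upper finite_subset)
  have "\<forall>P x. \<exists>A. P \<in> S \<longrightarrow> x \<in> X \<longrightarrow> A \<in> P \<and> x \<in> A"
    using part by (metis UnionE partition_onD1)
  then obtain block where block: "\<And>P x. P \<in> S \<Longrightarrow> x \<in> X \<Longrightarrow> block P x \<in> P"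
    "\<And>P x. P \<in> S \<Longrightarrow> x \<in> X \<Longrightarrow> x \<in> block P x"
    by metis
  have block_eq: "block P x = A" if "P \<in> S" "A \<in> P" "x \<in> A" for P A x
  proof -
    have "x \<in> X" using part[OF that(1)] that by (auto dest: partition_onD1)
    then have "block P x \<in> P" "x \<in> block P x \<inter> A" using block that by auto
    then show ?thesis
      using disjointD[OF partition_onD2[OF part[OF that(1)]] _ that(2)] by blast
  qed
  \<comment> \<open>A part \<open>{x}\<close> would lie inside the part through \<open>x\<close> of
    any other partition, and \<open>big\<close> provides another one.\<close>
  have card2: "card A \<ge> 2" if P: "P \<in> S" "A \<in> P" for P A
  proof (rule ccontr)
    assume "\<not> card A \<ge> 2"
    moreover have "A \<noteq> {}" using part[OF P(1)] P by (auto simp: partition_on_def)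
    ultimately have "card A = 1" using finA[OF P] by (simp add: card_gt_0_iff order_antisym Suc_leI)
    then obtain x where x: "A = {x}" by (auto simp: card_1_singleton_iff)
    have xX: "x \<in> X" using part[OF P(1)] P x by (auto dest: partition_onD1)
    have "S \<noteq> {P}" using big by auto
    then obtain Q where "Q \<in> S" "P \<noteq> Q" using P by blast
    then show False using sperner[OF P(1) _ _ P(2), of Q "block Q x"] block[OF _ xX] x by auto
  qed
  define v :: "nat \<Rightarrow> int" where "v c = (if c = 2 then 2 else if c = 3 then 0 else -1)" for c
  define g where "g x = (\<Sum>P\<in>S. v (card (block P x)))" for x
  have "8 \<le> (\<Sum>x\<in>X. v (card (block P x)))" if P: "P \<in> S" for P
  proof -
    have "int n = (\<Sum>A\<in>P. int (card A))"
      using product_partition[OF part[OF P] finA[OF P]] X(2) by simp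
    moreover have "int n = 3 * int k - 2" using n h by linarith
    \<comment> \<open>The linear function \<open>12 - 4 * c\<close> is at most
      \<open>c * v c\<close> for all \<open>c \<ge> 2\<close>, with equality at 2, 3 and 4; its sum
      depends only on \<open>k\<close> and \<open>n\<close>.\<close>
    ultimately have "8 = (\<Sum>A\<in>P. 12 - 4 * int (card A))"
      using card_k[OF P] by (simp add: sum_subtractf sum_distrib_left[symmetric])
    also have "\<dots> \<le> (\<Sum>A\<in>P. \<Sum>x\<in>A. v (card (block P x)))"
    proof (rule sum_mono)
      fix A assume A: "A \<in> P"
      have "(\<Sum>x\<in>A. v (card (block P x))) = int (card A) * v (card A)"
        using block_eq[OF P A] by simp
      then show "12 - 4 * int (card A) \<le> (\<Sum>x\<in>A. v (card (block P x)))"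
        using card2[OF P A] by (auto simp: v_def)
    qed
    also have "\<dots> = (\<Sum>x\<in>\<Union>P. v (card (block P x)))"
      using part[OF P] finA[OF P]
      by (intro sum.Union_disjoint[symmetric, unfolded comp_def]) (auto simp: partition_on_def disjoint_def)
    finally show ?thesis using partition_onD1[OF part[OF P]] by simp
  qed
  then have "(\<Sum>P\<in>S. 8) \<le> (\<Sum>P\<in>S. \<Sum>x\<in>X. v (card (block P x)))" by (intro sum_mono)
  also have "\<dots> = (\<Sum>x\<in>X. g x)" unfolding g_def by (rule sum.swap)
  finally have g_sum: "8 * int (card S) \<le> (\<Sum>x\<in>X. g x)" by simp
  \<comment> \<open>Some point reaches the average of \<open>g\<close> over the \<open>2 * h\<close>
    points.\<close>
  have "\<exists>x\<in>X. 4 * int (card S) \<le> int h * g x"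
  proof (rule ccontr)
    assume "\<not> ?thesis"
    then have "(\<Sum>x\<in>X. int h * g x) < of_nat (card X) * (4 * int (card S))"
      using X n h by (intro sum_bounded_above_strict) auto
    also have "of_nat (card X) * (4 * int (card S)) = int h * (8 * int (card S))"
      unfolding X(2) n(2) by simp
    finally have "int h * (\<Sum>x\<in>X. g x) < int h * (8 * int (card S))"
      by (simp add: sum_distrib_left)
    then show False using g_sum h by simp
  qed
  then obtain x where x: "x \<in> X" "4 * int (card S) \<le> int h * g x" by blast
  let ?\<beta> = "\<lambda>P. block P x - {x}"
  define F where "F = ?\<beta> ` S"
  \<comment> \<open>All these parts contain \<open>x\<close>, so deleting it preserves
    non-inclusion.\<close>
  have anti: "\<not> ?\<beta> P \<subseteq> ?\<beta> Q" if "P \<in> S" "Q \<in> S" "P \<noteq> Q" for P Q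
    using sperner[OF that block(1)[OF that(1) x(1)] block(1)[OF that(2) x(1)]]
      block(2)[OF that(2) x(1)] by blast
  have inj: "inj_on ?\<beta> S"
  proof (rule inj_onI, rule ccontr)
    fix P Q assume "P \<in> S" "Q \<in> S" "?\<beta> P = ?\<beta> Q" "P \<noteq> Q"
    then show False using anti[of P Q] by simp
  qed
  have card_\<beta>: "card (block P x) = Suc (card (?\<beta> P))" if "P \<in> S" for P
    using block[OF that x(1)] finA[OF that] by (metis card_Suc_Diff1)
  have ge1: "card A \<ge> 1" if "A \<in> F" for A
    using that card_\<beta> card2 block(1)[OF _ x(1)] unfolding F_def by fastforce
  let ?D = "{A\<in>F. card A = 1}" and ?B = "{A\<in>F. card A = 2}" and ?E = "{A\<in>F. card A \<ge> 3}"
  have split: "F = ?D \<union> ?B \<union> ?E" using ge1 by force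
  have finF: "finite ?D" "finite ?B" "finite ?E" using finS by (auto simp: F_def)
  have dis: "?D \<inter> ?B = {}" "(?D \<union> ?B) \<inter> ?E = {}" by auto
  have "card S = card F" unfolding F_def using inj by (simp add: card_image)
  also have "\<dots> = card ?D + card ?B + card ?E"
    by (subst split) (use finF dis in \<open>simp add: card_Un_disjoint\<close>)
  finally have total: "card S = card ?D + card ?B + card ?E" .
  have "g x = (\<Sum>A\<in>F. v (Suc (card A)))"
    unfolding g_def F_def using card_\<beta> by (subst sum.reindex[OF inj]) simp
  also have "\<dots> = (\<Sum>A\<in>?D. v (Suc (card A))) + (\<Sum>A\<in>?B. v (Suc (card A))) + (\<Sum>A\<in>?E. v (Suc (card A)))"
    by (subst split) (use finF dis in \<open>simp add: sum.union_disjoint\<close>)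
  also have "(\<Sum>A\<in>?D. v (Suc (card A))) = (\<Sum>A\<in>?D. 2)" by (rule sum.cong) (auto simp: v_def)
  also have "(\<Sum>A\<in>?B. v (Suc (card A))) = (\<Sum>A\<in>?B. 0)" by (rule sum.cong) (auto simp: v_def)
  also have "(\<Sum>A\<in>?E. v (Suc (card A))) = (\<Sum>A\<in>?E. -1)" by (rule sum.cong) (auto simp: v_def)
  finally have gx: "g x = 2 * int (card ?D) - int (card ?E)" by simp
  have "int h * (2 * (int h - 1)) = 4 * int (h choose 2)"
    using int_choose_two[of h] by (simp add: algebra_simps)
  \<comment> \<open>Strictness matters: \<open>g x\<close> is an integer, so it is at least
    \<open>2 * h - 1\<close>, as the extremal inequality requires.\<close>
  then have "int h * (2 * (int h - 1)) < int h * g x" using x(2) big by linarith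
  then have "2 * (int h - 1) < g x" using h by simp
  then have "int (card ?E + 2 * h) \<le> int (2 * card ?D + 1)" unfolding gx by simp
  then have E: "card ?E + 2 * h \<le> 2 * card ?D + 1" by (simp only: of_nat_le_iff)
  have V: "finite (X - {x})" "card (X - {x}) = 2 * h - 1" using X x n by auto
  have FV: "A \<subseteq> X - {x}" if "A \<in> F" for A
    using that block(1)[OF _ x(1)] partition_onD1[OF part] unfolding F_def by blast
  have antiF: "\<not> A \<subseteq> B" if "A \<in> F" "B \<in> F" "A \<noteq> B" for A B
    using that anti unfolding F_def by blast
  note profile = antichain_size_profile[of "X - {x}" F, OF V(1) FV antiF]
  have "card ?D + card ?B + card ?E \<le> (h choose 2) + 1"
  proof (rule extremal_inequality[OF h])
    show "card ?D + (card (X - {x}) - card ?D) + 1 = 2 * h" using profile(1) V(2) h by simp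
    show "card ?B + 3 \<le> (card (X - {x}) - card ?D) choose 2" if "card ?E > 0"
    proof (rule profile(3))
      show "?E \<noteq> {}"
        using that card_gt_0_iff by blast
    qed
  qed (use E profile(2) in auto)
  then show False using total big by simp
qed

theorem theorem3:
  fixes k n :: nat
  assumes "k \<ge> 4" and "even k" and "n = 3 * k - 2"
  shows "SP n k \<in> {(n div 2) choose 2, ((n div 2) choose 2) + 1}"
proof -
  obtain m where k: "k = 2 * m" using assms(2) by blast
  define h where "h = 3 * m - 1"
  have h: "Suc h = 3 * m" "n = 2 * h" "h \<ge> 5" using assms k by (auto simp: h_def)
  obtain X :: "(nat \<times> bool) set" and S
    where "sperner_partition_system n k X S" "card S = h choose 2"
    using exists_sperner_partition_system[OF h(1)] unfolding h(2) k by blast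
  then have "h choose 2 \<le> SP n k" using SP_upper by metis
  moreover obtain Y :: "nat set" and R
    where "sperner_partition_system n k Y R" "card R = SP n k"
    using SP_attained by blast
  then have "SP n k \<le> (h choose 2) + 1"
    using sperner_partition_system_card_bound[OF _ assms(3) h(2,3)] by metis
  ultimately show ?thesis using h(2) by auto
qed

end
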